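(* The following inclusions between classes of sequences of nonnegative real numbers hold: (i) $NIS\subset NIMS$; (ii) $NDS\subset NDMS$; (iii) $AMDS\subset AMDMS$; (iv) $AMIS\subset AMIMS$.
   Context: All sequences $c=(c_n)_{n\ge 0}$ consist of nonnegative real numbers. For such a sequence, let $C=(C_n)_{n\ge 0}$ be its sequence of arithmetic means, $C_n=\frac{1}{n+1}\sum_{k=0}^{n}c_k$. $NDS$ (resp. $NIS$) is the class of nonnegative nondecreasing (resp. nonincreasing) sequences. $c\in NDMS$ (resp. $c\in NIMS$) means $C\in NDS$ (resp. $C\in NIS$). $c\in AMDS$ (almost monotone decreasing) means there is a constant $K=K(c)$, depending only on the sequence $c$, such that $c_n\le K c_m$ for all $n\ge m\ge 0$. $c\in AMIS$ (almost monotone increasing) means there is a constant $K=K(c)$, depending only on the sequence $c$, such that $K c_n\ge c_m$ for all $n\ge m\ge 0$. $c\in AMDMS$ (resp. $c\in AMIMS$) means $C\in AMDS$ (resp. $C\in AMIS$). *)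

theory Defs
  imports Complex_Main
begin

definition nonneg_seqs :: "(nat \<Rightarrow> real) set" where
  "nonneg_seqs = {c. \<forall>n. 0 \<le> c n}"

definition arith_means :: "(nat \<Rightarrow> real) \<Rightarrow> nat \<Rightarrow> real" where
  "arith_means c n = 1 / (real n + 1) * (\<Sum>k=0..n. c k)"

definition NDS :: "(nat \<Rightarrow> real) set" where
  "NDS = {c \<in> nonneg_seqs. incseq c}"

definition NIS :: "(nat \<Rightarrow> real) set" where
  "NIS = {c \<in> nonneg_seqs. decseq c}"

definition AMDS :: "(nat \<Rightarrow> real) set" where
  "AMDS = {c \<in> nonneg_seqs. \<exists>K::real. \<forall>n m. n \<ge> m \<longrightarrow> c n \<le> K * c m}"

definition AMIS :: "(nat \<Rightarrow> real) set" where
  "AMIS = {c \<in> nonneg_seqs. \<exists>K::real. \<forall>n m. n \<ge> m \<longrightarrow> K * c n \<ge> c m}"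

definition NDMS :: "(nat \<Rightarrow> real) set" where
  "NDMS = {c \<in> nonneg_seqs. arith_means c \<in> NDS}"

definition NIMS :: "(nat \<Rightarrow> real) set" where
  "NIMS = {c \<in> nonneg_seqs. arith_means c \<in> NIS}"

definition AMDMS :: "(nat \<Rightarrow> real) set" where
  "AMDMS = {c \<in> nonneg_seqs. arith_means c \<in> AMDS}"

definition AMIMS :: "(nat \<Rightarrow> real) set" where
  "AMIMS = {c \<in> nonneg_seqs. arith_means c \<in> AMIS}"

end

theory Submission
  imports Defs
begin

text \<open>For \<open>m < i\<close>, averaging the almost-monotonicity inequality between \<open>c k\<close> and \<open>c i\<close> over
  \<open>k \<le> m\<close> compares the mean of index \<open>m\<close> with \<open>c i\<close>. The mean of index \<open>n\<close> is a convex
  combination of the mean of index \<open>m\<close> and the terms \<open>c i\<close> with \<open>m < i \<le> n\<close>, so the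
  same inequality holds for the means, with the same constant \<open>K\<close> as soon as \<open>K \<ge> 1\<close>. The case
  \<open>K = 1\<close> gives the monotone classes.\<close>

lemma sum_eq_arith_means: "(\<Sum>k=0..n. c k) = (real n + 1) * arith_means c n"
  by (simp add: arith_means_def)

lemma arith_means_nonneg: "c \<in> nonneg_seqs \<Longrightarrow> 0 \<le> arith_means c n"
  by (simp add: arith_means_def nonneg_seqs_def sum_nonneg)

lemma arith_means_split:
  assumes "m \<le> n"
  shows "(real n + 1) * arith_means c n = (real m + 1) * arith_means c m + (\<Sum>i\<in>{m<..n}. c i)"
proof -
  have "{0..n} = {0..m} \<union> {m<..n}"
    using assms by auto
  then have "(\<Sum>k=0..n. c k) = (\<Sum>k=0..m. c k) + (\<Sum>i\<in>{m<..n}. c i)"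
    by (simp add: sum.union_disjoint ivl_disj_int)
  then show ?thesis
    by (simp only: sum_eq_arith_means)
qed

lemma arith_means_almost_decreasing:
  assumes c: "c \<in> nonneg_seqs" and K: "1 \<le> K"
    and le: "\<And>m n. m \<le> n \<Longrightarrow> c n \<le> K * c m" and "m \<le> n"
  shows "arith_means c n \<le> K * arith_means c m"
proof -
  let ?C = "arith_means c m"
  \<comment> \<open>Every \<open>k \<le> m\<close> lies below \<open>i\<close>, so
    \<open>c i \<le> K * c k\<close>; the average of the right-hand sides over these
    \<open>k\<close> is \<open>K * ?C\<close>.\<close>
  have tail: "c i \<le> K * ?C" if "i \<in> {m<..n}" for i
  proof -
    have "(\<Sum>k=0..m. c i) \<le> (\<Sum>k=0..m. K * c k)"
      using that by (intro sum_mono le) auto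
    then have "(real m + 1) * c i \<le> (real m + 1) * (K * ?C)"
      by (simp add: sum_distrib_left[symmetric] sum_eq_arith_means algebra_simps)
    then show ?thesis
      by (rule mult_left_le_imp_le) simp
  qed
  \<comment> \<open>The head of the sum carries no factor \<open>K\<close>. Since \<open>?C\<close>
    is nonnegative, \<open>1 \<le> K\<close> lets it share the bound \<open>K * ?C\<close> with the
    tail.\<close>
  have "?C \<le> K * ?C"
    using mult_right_mono[OF K arith_means_nonneg[OF c]] by simp
  then have "(real m + 1) * ?C \<le> (real m + 1) * (K * ?C)"
    by (intro mult_left_mono) auto
  \<comment> \<open>The tail has \<open>n - m\<close> terms; with the head weight
    \<open>m + 1\<close> the total weight is \<open>n + 1\<close>, which then cancels.\<close>
  moreover have "(\<Sum>i\<in>{m<..n}. c i) \<le> (real n - real m) * (K * ?C)"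
    using sum_bounded_above[of "{m<..n}" c "K * ?C"] tail \<open>m \<le> n\<close> by (simp add: of_nat_diff)
  ultimately have "(real n + 1) * arith_means c n \<le> (real n + 1) * (K * ?C)"
    unfolding arith_means_split[OF \<open>m \<le> n\<close>] by (simp add: algebra_simps)
  then show ?thesis
    by (rule mult_left_le_imp_le) simp
qed

lemma arith_means_almost_increasing:
  assumes c: "c \<in> nonneg_seqs" and K: "1 \<le> K"
    and le: "\<And>m n. m \<le> n \<Longrightarrow> c m \<le> K * c n" and "m \<le> n"
  shows "arith_means c m \<le> K * arith_means c n"
proof -
  let ?C = "arith_means c m"
  have tail: "?C \<le> K * c i" if "i \<in> {m<..n}" for i
  proof -
    have "(\<Sum>k=0..m. c k) \<le> (\<Sum>k=0..m. K * c i)"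
      using that by (intro sum_mono le) auto
    then have "(real m + 1) * ?C \<le> (real m + 1) * (K * c i)"
      by (simp add: sum_eq_arith_means algebra_simps)
    then show ?thesis
      by (rule mult_left_le_imp_le) simp
  qed
  have "?C \<le> K * ?C"
    using mult_right_mono[OF K arith_means_nonneg[OF c]] by simp
  then have "(real m + 1) * ?C \<le> (real m + 1) * (K * ?C)"
    by (intro mult_left_mono) auto
  \<comment> \<open>The lower bound is for the scaled terms \<open>K * c i\<close>, so no division
    by \<open>K\<close> is needed; \<open>K\<close> is then pulled out of the sum.\<close>
  moreover have "(real n - real m) * ?C \<le> K * (\<Sum>i\<in>{m<..n}. c i)"
    using sum_bounded_below[of "{m<..n}" ?C "\<lambda>i. K * c i"] tail \<open>m \<le> n\<close>
    by (simp add: of_nat_diff sum_distrib_left)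
  ultimately have "(real n + 1) * ?C \<le> K * ((real n + 1) * arith_means c n)"
    unfolding arith_means_split[OF \<open>m \<le> n\<close>] by (simp add: algebra_simps)
  then have "(real n + 1) * ?C \<le> (real n + 1) * (K * arith_means c n)"
    by (simp add: mult.left_commute)
  then show ?thesis
    by (rule mult_left_le_imp_le) simp
qed

lemma arith_means_in_nonneg_seqs: "c \<in> nonneg_seqs \<Longrightarrow> arith_means c \<in> nonneg_seqs"
  using arith_means_nonneg by (simp add: nonneg_seqs_def)

text \<open>Enlarging the constant is harmless because \<open>y\<close> is nonnegative. In the
  almost monotone classes, taking equal indices shows that \<open>K < 1\<close> occurs only for the
  zero sequence; passing to \<open>max 1 K\<close> avoids that case distinction.\<close>

lemma le_max_one_mult:
  fixes x y K :: real
  assumes "x \<le> K * y" and "0 \<le> y"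
  shows "x \<le> max 1 K * y"
  using assms mult_right_mono[of K "max 1 K" y] by simp

lemma NIS_subset_NIMS: "NIS \<subseteq> NIMS"
  using arith_means_almost_decreasing[where K = 1] arith_means_in_nonneg_seqs
  by (auto simp: NIS_def NIMS_def decseq_def)

lemma NDS_subset_NDMS: "NDS \<subseteq> NDMS"
  using arith_means_almost_increasing[where K = 1] arith_means_in_nonneg_seqs
  by (auto simp: NDS_def NDMS_def incseq_def)

lemma AMDS_subset_AMDMS: "AMDS \<subseteq> AMDMS"
proof
  fix c assume "c \<in> AMDS"
  then obtain K where c: "c \<in> nonneg_seqs" and K: "\<And>m n. m \<le> n \<Longrightarrow> c n \<le> K * c m"
    by (auto simp: AMDS_def)
  have "c n \<le> max 1 K * c m" if "m \<le> n" for m n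
    using le_max_one_mult[OF K[OF that]] c by (simp add: nonneg_seqs_def)
  then have "arith_means c n \<le> max 1 K * arith_means c m" if "m \<le> n" for m n
    using arith_means_almost_decreasing[OF c] that by simp
  then show "c \<in> AMDMS"
    using c arith_means_in_nonneg_seqs by (auto simp: AMDMS_def AMDS_def)
qed

lemma AMIS_subset_AMIMS: "AMIS \<subseteq> AMIMS"
proof
  fix c assume "c \<in> AMIS"
  then obtain K where c: "c \<in> nonneg_seqs" and K: "\<And>m n. m \<le> n \<Longrightarrow> c m \<le> K * c n"
    by (auto simp: AMIS_def)
  have "c m \<le> max 1 K * c n" if "m \<le> n" for m n
    using le_max_one_mult[OF K[OF that]] c by (simp add: nonneg_seqs_def)
  then have "arith_means c m \<le> max 1 K * arith_means c n" if "m \<le> n" for m n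
    using arith_means_almost_increasing[OF c] that by simp
  then show "c \<in> AMIMS"
    using c arith_means_in_nonneg_seqs by (auto simp: AMIMS_def AMIS_def)
qed

theorem theorem4:
  shows "NIS \<subseteq> NIMS \<and> NDS \<subseteq> NDMS \<and> AMDS \<subseteq> AMDMS \<and> AMIS \<subseteq> AMIMS"
  using NIS_subset_NIMS NDS_subset_NDMS AMDS_subset_AMDMS AMIS_subset_AMIMS by blast

end
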